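(* Let $W, A \in \mathbb{R}^{n\times n}$ be symmetric matrices with $A \ge \mathbf{0}$ entrywise and $W_{ij}A_{ij} = 0$ for all $i,j$. For each $i \in \{1,\dots,n\}$ let $\mathcal{N}(i) := \{ j \neq i : A_{ij} \neq 0\}$, and let $$\lambda_i = \frac{W^+_{ii}}{2} + \sum_{j \notin \mathcal{N}(i),\, j\neq i} W^+_{ij}.$$ Let $\Lambda = [\lambda_{ij}] \in \mathbb{R}^{n\times n}$ be a symmetric matrix such that $$\lambda_{ij} = \lambda_{ji} > \frac{\max\{\lambda_i, \lambda_j\}}{A_{ij}}$$ for those $i$ and $j$ with $A_{ij} \neq 0$, and $\lambda_{ij} = 0$ otherwise. Then the unconstrained problem $$\max_{x \in \{0,1\}^n} \ x^t W x - x^t (\Lambda \bullet A)\, x$$ solves the constrained problem $$\max\ \{ x^t W x \;:\; x^t A x = 0,\ x \in \{0,1\}^n \},$$ that is, every optimal solution of the unconstrained problem is feasible, and hence optimal, for the constrained problem.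
   Context: $W^+$ denotes the matrix containing the non-negative entries of $W$: $W^+_{ij} = W_{ij}$ if $W_{ij} \ge 0$ and $W^+_{ij} = 0$ otherwise. The symbol $\bullet$ denotes the Hadamard (entrywise) product of matrices. The constrained problem is called the generalized quadratic stable set problem (GQSS).
   Formalization: The formal theorem additionally assumes λ_ii > 2λ_i/A_ii whenever A_ii ≠ 0; without it the claim fails, e.g. W = [[0,1],[1,0]], A = diag(1,0), Λ = diag(3/2,0). If A has zero diagonal, nothing is added. *)

theory Defs
  imports "HOL-Analysis.Analysis"
begin

definition quad_form :: "real^'n^'n \<Rightarrow> real^'n \<Rightarrow> real" where
  "quad_form M x = x \<bullet> (M *v x)"

definition binary_vec :: "real^'n \<Rightarrow> bool" where
  "binary_vec x \<longleftrightarrow> (\<forall>i. x $ i = 0 \<or> x $ i = 1)"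

definition nonneg_part :: "real^'n^'n \<Rightarrow> real^'n^'n" where
  "nonneg_part W = (\<chi> i j. if W $ i $ j \<ge> 0 then W $ i $ j else 0)"

definition nbhd :: "real^'n^'n \<Rightarrow> 'n \<Rightarrow> 'n set" where
  "nbhd A i = {j. j \<noteq> i \<and> A $ i $ j \<noteq> 0}"

text \<open>
  Switching \<open>x $ i\<close> from 1 to 0 decreases \<open>quad_form W x\<close> by at most
  \<open>2 * penalty_threshold W A i\<close>. An off-diagonal penalty \<open>\<Lambda>\<^sub>i\<^sub>j A\<^sub>i\<^sub>j\<close> occurs twice in the
  quadratic form (as \<open>(i, j)\<close> and \<open>(j, i)\<close>), so it has to exceed only the threshold itself;
  a diagonal penalty \<open>\<Lambda>\<^sub>i\<^sub>i A\<^sub>i\<^sub>i\<close> occurs once and has to exceed twice the threshold.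
\<close>

definition penalty_threshold :: "real^'n^'n \<Rightarrow> real^'n^'n \<Rightarrow> 'n \<Rightarrow> real" where
  "penalty_threshold W A i =
     nonneg_part W $ i $ i / 2 + (\<Sum>j\<in>{j. j \<notin> nbhd A i \<and> j \<noteq> i}. nonneg_part W $ i $ j)"

text \<open>
  Multiplication \<open>*\<close> on \<open>real^'n^'n\<close> is entrywise, so \<open>\<Lambda> * A\<close> below is the Hadamard product
  (the matrix product would be \<open>\<Lambda> ** A\<close>). In both problems, an optimal solution is
  a maximizer in the sense of \<^const>\<open>is_arg_max\<close>, which includes feasibility.
\<close>

definition gqss_optimal :: "real^'n^'n \<Rightarrow> real^'n^'n \<Rightarrow> real^'n \<Rightarrow> bool" where
  "gqss_optimal W A x \<longleftrightarrow>
     is_arg_max (quad_form W) (\<lambda>y. quad_form A y = 0 \<and> binary_vec y) x"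

definition penalized_optimal ::
    "real^'n^'n \<Rightarrow> real^'n^'n \<Rightarrow> real^'n^'n \<Rightarrow> real^'n \<Rightarrow> bool" where
  "penalized_optimal W A \<Lambda> x \<longleftrightarrow>
     is_arg_max (\<lambda>y. quad_form W y - quad_form (\<Lambda> * A) y) binary_vec x"

end

theory Submission
  imports Defs
begin

text \<open>
  The idea is a one-vertex exchange. Suppose a binary \<open>x\<close> violates the constraint. Since \<open>A\<close> is
  nonnegative, its form is a sum of nonnegative terms, so some entry \<open>A\<^sub>i\<^sub>j \<noteq> 0\<close> has
  \<open>x\<^sub>i = x\<^sub>j = 1\<close>. Switching \<open>x\<^sub>i\<close> off removes from the penalized objective exactly row and column \<open>i\<close>.
  The \<open>W\<close> part of what is lost is at most twice the threshold of \<open>i\<close>: as \<open>W\<close> vanishes wherever \<open>A\<close>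
  does not, only \<open>i\<close> itself and its non-neighbours contribute, each
  at most through its positive part. The
  penalty that is saved is strictly larger: every penalty is nonnegative, and the violated
  entry alone, counted twice if \<open>i \<noteq> j\<close> and once if \<open>i = j\<close>, already exceeds twice the
  threshold. So the switch strictly improves the objective (\<open>violated_entry_improvable\<close>), and a
  maximizer must be feasible.

  Optimality for the constrained problem follows because the penalty vanishes
  on all feasible points (\<open>penalty_vanishes_if_feasible\<close>), where the two objectives therefore agree.
\<close>

lemma quad_form_eq_sum: "quad_form M x = (\<Sum>i\<in>UNIV. \<Sum>j\<in>UNIV. M $ i $ j * x $ i * x $ j)"
  by (simp add: quad_form_def inner_vec_def matrix_vector_mult_def sum_distrib_left mult_ac)

lemma quad_form_diff: "quad_form M x - quad_form N x = quad_form (M - N) x"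
  by (simp add: quad_form_def matrix_vector_mult_diff_rdistrib inner_diff_right)

text \<open>
  Nonnegativity rules out cancellation in the form, so that one scalar constraint encodes
  independence: no two chosen indices, equal or not, meet in a nonzero entry.
\<close>

lemma quad_form_eq_0_iff:
  assumes nonneg: "\<And>i j. A $ i $ j \<ge> 0" and x: "binary_vec x"
  shows "quad_form A x = 0 \<longleftrightarrow> (\<forall>i j. A $ i $ j * x $ i * x $ j = 0)"
proof -
  have "x $ i \<ge> 0" for i
    using x by (metis binary_vec_def order_refl zero_le_one)
  then have "A $ i $ j * x $ i * x $ j \<ge> 0" for i j
    using nonneg by simp
  then show ?thesis
    by (simp add: quad_form_eq_sum sum_nonneg_eq_0_iff sum_nonneg)
qed

lemma penalty_vanishes_if_feasible:
  assumes "\<And>i j. A $ i $ j \<ge> 0" "binary_vec x" "quad_form A x = 0"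
  shows "quad_form (\<Lambda> * A) x = 0"
proof -
  have "A $ i $ j * x $ i * x $ j = 0" for i j
    using assms quad_form_eq_0_iff by blast
  then have "(\<Lambda> * A) $ i $ j * x $ i * x $ j = 0" for i j
    by auto
  then show ?thesis
    by (simp only: quad_form_eq_sum sum.neutral_const)
qed

text \<open>
  The diagonal entry is counted once and each off-diagonal entry twice, by symmetry; this
  asymmetry is the reason for the factors in the threshold.
\<close>

lemma quad_form_switch_off:
  assumes sym: "transpose M = M" and xi: "x $ i = 1"
  shows "quad_form M x - quad_form M (x - axis i 1)
       = M $ i $ i + 2 * (\<Sum>j\<in>UNIV - {i}. M $ i $ j * x $ j)"
proof -
  have "x \<bullet> (M *v axis i 1) = axis i 1 \<bullet> (M *v x)"
    by (metis dot_lmul_matrix inner_commute sym transpose_matrix_vector)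
  moreover have "axis i 1 \<bullet> (M *v x) = (M *v x) $ i"
    by (simp add: inner_axis')
  moreover have "axis i 1 \<bullet> (M *v axis i 1) = M $ i $ i"
    by (simp add: inner_axis' matrix_vector_mult_basis column_def)
  moreover have "(M *v x) $ i = M $ i $ i + (\<Sum>j\<in>UNIV - {i}. M $ i $ j * x $ j)"
    by (simp add: matrix_vector_mult_def sum.remove[of UNIV i] xi)
  ultimately show ?thesis
    by (simp add: quad_form_def matrix_vector_mult_diff_distrib inner_diff_left inner_diff_right)
qed

lemma nonneg_part_nonneg: "nonneg_part W $ i $ j \<ge> 0"
  by (simp add: nonneg_part_def)

lemma le_nonneg_part: "W $ i $ j \<le> nonneg_part W $ i $ j"
  by (simp add: nonneg_part_def)

lemma penalty_threshold_nonneg: "penalty_threshold W A i \<ge> 0"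
  by (simp add: penalty_threshold_def nonneg_part_nonneg sum_nonneg)

text \<open>
  The penalties are packed into one matrix \<open>P\<close>, so that the estimate does not depend on how they
  arise. It bounds what switching \<open>x\<^sub>i\<close> off costs. The indices \<open>j \<noteq> i\<close> split into non-neighbours, where
  \<open>P\<close> vanishes, and neighbours, where \<open>W\<close> does.
\<close>

lemma switch_off_loss_le:
  assumes x: "binary_vec x"
    and W0: "\<And>j. A $ i $ j \<noteq> 0 \<Longrightarrow> W $ i $ j = 0"
    and P0: "\<And>j. A $ i $ j = 0 \<Longrightarrow> P $ i $ j = 0"
  shows "(W - P) $ i $ i + 2 * (\<Sum>j\<in>UNIV - {i}. (W - P) $ i $ j * x $ j)
       \<le> 2 * penalty_threshold W A i - P $ i $ i - 2 * (\<Sum>j\<in>nbhd A i. P $ i $ j * x $ j)"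
proof -
  let ?far = "{j. j \<notin> nbhd A i \<and> j \<noteq> i}"
  have "UNIV - {i} = ?far \<union> nbhd A i"
    by (auto simp: nbhd_def)
  then have "(\<Sum>j\<in>UNIV - {i}. (W - P) $ i $ j * x $ j)
      = (\<Sum>j\<in>?far. (W - P) $ i $ j * x $ j) + (\<Sum>j\<in>nbhd A i. (W - P) $ i $ j * x $ j)"
    by (simp add: sum.union_disjoint disjoint_iff)
  moreover have "(\<Sum>j\<in>?far. (W - P) $ i $ j * x $ j) \<le> (\<Sum>j\<in>?far. nonneg_part W $ i $ j)"
  proof (rule sum_mono)
    fix j assume "j \<in> ?far"
    then have "(W - P) $ i $ j = W $ i $ j"
      using P0 by (auto simp: nbhd_def)
    moreover have "x $ j = 0 \<or> x $ j = 1"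
      using x by (simp add: binary_vec_def)
    ultimately show "(W - P) $ i $ j * x $ j \<le> nonneg_part W $ i $ j"
      using le_nonneg_part nonneg_part_nonneg by auto
  qed
  moreover have "(\<Sum>j\<in>nbhd A i. (W - P) $ i $ j * x $ j) = - (\<Sum>j\<in>nbhd A i. P $ i $ j * x $ j)"
    using W0 by (simp add: nbhd_def flip: sum_negf)
  ultimately show ?thesis
    using le_nonneg_part[of W i i] by (simp add: penalty_threshold_def)
qed

text \<open>
  The saving in penalty is at least the contribution of the violated entry, the others being
  nonnegative. A violated diagonal entry is counted once only and hence needs its own, doubled bound.
\<close>

lemma violated_entry_improvable:
  assumes x: "binary_vec x" and sym: "transpose W = W" "transpose P = P"
    and W0: "\<And>j. A $ i $ j \<noteq> 0 \<Longrightarrow> W $ i $ j = 0"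
    and P0: "\<And>j. A $ i $ j = 0 \<Longrightarrow> P $ i $ j = 0"
    and P_gt: "\<And>j. A $ i $ j \<noteq> 0 \<Longrightarrow> P $ i $ j > penalty_threshold W A i"
    and P_gt_diag: "A $ i $ i \<noteq> 0 \<Longrightarrow> P $ i $ i > 2 * penalty_threshold W A i"
    and violated: "A $ i $ k \<noteq> 0" "x $ i = 1" "x $ k = 1"
  shows "quad_form (W - P) x < quad_form (W - P) (x - axis i 1)"
proof -
  let ?t = "penalty_threshold W A i" and ?S = "\<Sum>j\<in>nbhd A i. P $ i $ j * x $ j"
  have P_nonneg: "P $ i $ j \<ge> 0" for j
    using P0 P_gt[of j] penalty_threshold_nonneg[of W A i] by (cases "A $ i $ j = 0") auto
  have terms_nonneg: "P $ i $ j * x $ j \<ge> 0" for j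
    using P_nonneg[of j] x by (metis binary_vec_def mult.right_neutral mult_zero_right order_refl)
  have "2 * ?t < P $ i $ i + 2 * ?S"
  proof (cases "k = i")
    case True
    have "?S \<ge> 0"
      by (simp add: sum_nonneg terms_nonneg)
    then show ?thesis
      using P_gt_diag violated True by auto
  next
    case False
    then have "k \<in> nbhd A i"
      using violated by (simp add: nbhd_def)
    then have "P $ i $ k * x $ k \<le> ?S"
      by (intro member_le_sum) (auto simp: terms_nonneg)
    then show ?thesis
      using P_gt[OF violated(1)] P_nonneg[of i] violated(3) by simp
  qed
  moreover have "quad_form (W - P) x - quad_form (W - P) (x - axis i 1) \<le> 2 * ?t - P $ i $ i - 2 * ?S"
  proof -
    have "transpose (W - P) = W - P"
      using sym by (simp add: transpose_def vec_eq_iff)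
    then show ?thesis
      using switch_off_loss_le[OF x W0 P0] by (simp only: quad_form_switch_off[OF _ violated(2)])
  qed
  ultimately show ?thesis
    by linarith
qed

lemma binary_vec_switch_off:
  assumes "binary_vec x" "x $ i = 1"
  shows "binary_vec (x - axis i 1)"
  using assms by (auto simp: binary_vec_def axis_def)

theorem proposition2:
  fixes W A \<Lambda> :: "real^'n^'n"
  assumes "transpose W = W" and "transpose A = A"
    and "\<And>i j. A $ i $ j \<ge> 0"
    and "\<And>i j. W $ i $ j * A $ i $ j = 0"
    and "transpose \<Lambda> = \<Lambda>"
    and "\<And>i j. A $ i $ j \<noteq> 0 \<Longrightarrow>
           \<Lambda> $ i $ j > max (penalty_threshold W A i) (penalty_threshold W A j) / A $ i $ j"
    and "\<And>i j. A $ i $ j = 0 \<Longrightarrow> \<Lambda> $ i $ j = 0"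
    and "\<And>i. A $ i $ i \<noteq> 0 \<Longrightarrow> \<Lambda> $ i $ i > 2 * penalty_threshold W A i / A $ i $ i"
  shows "\<forall>x. penalized_optimal W A \<Lambda> x \<longrightarrow>
           quad_form A x = 0 \<and> binary_vec x \<and> gqss_optimal W A x"
proof (intro allI impI)
  fix x
  assume "penalized_optimal W A \<Lambda> x"
  then have x: "binary_vec x"
    and max: "\<And>y. binary_vec y \<Longrightarrow>
      quad_form W y - quad_form (\<Lambda> * A) y \<le> quad_form W x - quad_form (\<Lambda> * A) x"
    by (auto simp: penalized_optimal_def is_arg_max_def not_less)
  have feasible: "quad_form A x = 0"
  proof (rule ccontr)
    assume "quad_form A x \<noteq> 0"
    then obtain i k where ik: "A $ i $ k * x $ i * x $ k \<noteq> 0"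
      using quad_form_eq_0_iff assms(3) x by blast
    then have violated: "A $ i $ k \<noteq> 0" "x $ i = 1" "x $ k = 1"
      using x by (auto simp: binary_vec_def)
    have A_pos: "A $ i $ j > 0" if "A $ i $ j \<noteq> 0" for j
      using that assms(3)[of i j] by simp
    have "quad_form (W - \<Lambda> * A) x < quad_form (W - \<Lambda> * A) (x - axis i 1)"
    proof (rule violated_entry_improvable[OF x assms(1) _ _ _ _ _ violated])
      show "transpose (\<Lambda> * A) = \<Lambda> * A"
        using assms(2,5) by (simp add: transpose_def vec_eq_iff)
      show "W $ i $ j = 0" if "A $ i $ j \<noteq> 0" for j
        using assms(4)[of i j] that by simp
      show "(\<Lambda> * A) $ i $ j = 0" if "A $ i $ j = 0" for j
        using that by simp
      show "(\<Lambda> * A) $ i $ j > penalty_threshold W A i" if "A $ i $ j \<noteq> 0" for j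
        using assms(6)[OF that] A_pos[OF that] by (simp add: pos_divide_less_eq)
      show "(\<Lambda> * A) $ i $ i > 2 * penalty_threshold W A i" if "A $ i $ i \<noteq> 0"
        using assms(8)[OF that] A_pos[OF that] by (simp add: pos_divide_less_eq)
    qed
    then show False
      using max[OF binary_vec_switch_off[OF x violated(2)]] by (simp add: quad_form_diff)
  qed
  moreover have "gqss_optimal W A x"
    unfolding gqss_optimal_def is_arg_max_linorder
  proof (intro conjI allI impI feasible x)
    fix y assume "quad_form A y = 0 \<and> binary_vec y"
    then show "quad_form W y \<le> quad_form W x"
      using max[of y] penalty_vanishes_if_feasible[OF assms(3)] x feasible by simp
  qed
  ultimately show "quad_form A x = 0 \<and> binary_vec x \<and> gqss_optimal W A x"
    using x by blast
qed

end
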